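(* Let $(X,d)$ be a metric space and let $\mathfrak B$ be a bornology on $X$ such that $X\notin\mathfrak B$ and $X$ is $\mathfrak B^s$-Lindelöf. The following are equivalent: (1) $X$ satisfies $\alpha_2(\Gamma_{\mathfrak B^s},\Gamma_{\mathfrak B^s})$; (2) $X$ satisfies $\alpha_3(\Gamma_{\mathfrak B^s},\Gamma_{\mathfrak B^s})$; (3) $X$ satisfies $\alpha_4(\Gamma_{\mathfrak B^s},\Gamma_{\mathfrak B^s})$; (4) $X$ satisfies $\mathsf S_1(\Gamma_{\mathfrak B^s},\Gamma_{\mathfrak B^s})$.
   Context: A bornology on a metric space $(X,d)$ is a family $\mathfrak B$ of nonempty subsets of $X$ that is closed under finite unions, closed under taking nonempty subsets, and covers $X$. For $A\subset X$ and $\varepsilon>0$, $A^{\varepsilon}=\bigcup_{a\in A}\{y\in X: d(a,y)<\varepsilon\}$. A strong $\mathfrak B$-cover ($\mathfrak B^s$-cover) of $X$ is an open cover $\mathcal U$ of $X$ such that $X\notin\mathcal U$ and for each $B\in\mathfrak B$ there are $U\in\mathcal U$ and $\delta>0$ with $B^{\delta}\subset U$. $X$ is $\mathfrak B^s$-Lindelöf if every $\mathfrak B^s$-cover of $X$ contains a countable subfamily that is a $\mathfrak B^s$-cover. A countable open cover $\mathcal U=\{U_n:n\in\mathbb N\}$ of $X$ is a $\gamma_{\mathfrak B^s}$-cover if it is infinite and for each $B\in\mathfrak B$ there are $n_0\in\mathbb N$ and a sequence $(\delta_n:n\ge n_0)$ of positive reals such that $B^{\delta_n}\subset U_n$ for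 all $n\ge n_0$. $\Gamma_{\mathfrak B^s}$ is the collection of all $\gamma_{\mathfrak B^s}$-covers of $X$. $\mathsf S_1(\Gamma_{\mathfrak B^s},\Gamma_{\mathfrak B^s})$ is the statement: for each sequence $(\mathcal U_n:n\in\mathbb N)$ of elements of $\Gamma_{\mathfrak B^s}$ there is a sequence $(U_n:n\in\mathbb N)$ with $U_n\in\mathcal U_n$ for each $n$ and $\{U_n:n\in\mathbb N\}\in\Gamma_{\mathfrak B^s}$. For $i=2,3,4$, $X$ satisfies $\alpha_i(\Gamma_{\mathfrak B^s},\Gamma_{\mathfrak B^s})$ if for each sequence $(\mathcal U_n:n\in\mathbb N)$ of $\gamma_{\mathfrak B^s}$-covers of $X$ there is a $\gamma_{\mathfrak B^s}$-cover $\mathcal V$ of $X$ such that: for $i=2$: for each $n\in\mathbb N$, $\mathcal U_n\cap\mathcal V$ is infinite; for $i=3$: for infinitely many $n\in\mathbb N$, $\mathcal U_n\cap\mathcal V$ is infinite; for $i=4$: for infinitely many $n\in\mathbb N$, $\mathcal U_n\cap\mathcal V\neq\emptyset$. *)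

theory Defs
  imports "HOL-Analysis.Elementary_Metric_Spaces" "HOL-Library.Countable_Set"
begin

text \<open>
  The metric space \<open>X\<close> is an arbitrary type of class \<^class>\<open>metric_space\<close>, so \<open>X\<close> itself is
  \<^term>\<open>UNIV\<close>.
\<close>

definition bornology :: "'a::metric_space set set \<Rightarrow> bool" where
  "bornology \<BB> \<longleftrightarrow>
     {} \<notin> \<BB> \<and>
     (\<forall>\<F>. finite \<F> \<and> \<F> \<noteq> {} \<and> \<F> \<subseteq> \<BB> \<longrightarrow> \<Union>\<F> \<in> \<BB>) \<and>
     (\<forall>B\<in>\<BB>. \<forall>A. A \<noteq> {} \<and> A \<subseteq> B \<longrightarrow> A \<in> \<BB>) \<and>
     \<Union>\<BB> = UNIV"

definition enlargement :: "'a::metric_space set \<Rightarrow> real \<Rightarrow> 'a set" where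
  "enlargement A \<epsilon> = (\<Union>a\<in>A. ball a \<epsilon>)"

definition open_cover :: "'a::topological_space set set \<Rightarrow> bool" where
  "open_cover \<U> \<longleftrightarrow> (\<forall>U\<in>\<U>. open U) \<and> \<Union>\<U> = UNIV"

definition strong_cover :: "'a::metric_space set set \<Rightarrow> 'a set set \<Rightarrow> bool" where
  "strong_cover \<BB> \<U> \<longleftrightarrow>
     open_cover \<U> \<and> UNIV \<notin> \<U> \<and>
     (\<forall>B\<in>\<BB>. \<exists>U\<in>\<U>. \<exists>\<delta>>0. enlargement B \<delta> \<subseteq> U)"

definition strong_Lindelof :: "'a::metric_space set set \<Rightarrow> bool" where
  "strong_Lindelof \<BB> \<longleftrightarrow>
     (\<forall>\<U>. strong_cover \<BB> \<U> \<longrightarrow> (\<exists>\<V>\<subseteq>\<U>. countable \<V> \<and> strong_cover \<BB> \<V>))"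

text \<open>
  A \<open>\<gamma>\<close>-cover is a set of open sets that admits some enumeration with the stated property.  The
  enumeration may have repetitions; this makes no difference, since the property forces all but
  finitely many members of the cover to contain an enlargement of \<open>B\<close>.  Unlike for strong covers,
  the whole space is not excluded from being a member.
\<close>

definition gamma_covers :: "'a::metric_space set set \<Rightarrow> 'a set set set"  (\<open>\<Gamma>\<close>) where
  "\<Gamma> \<BB> = {\<U>. open_cover \<U> \<and> infinite \<U> \<and>
     (\<exists>U :: nat \<Rightarrow> 'a set. \<U> = range U \<and>
        (\<forall>B\<in>\<BB>. \<exists>n0. \<exists>\<delta> :: nat \<Rightarrow> real. \<forall>n\<ge>n0. \<delta> n > 0 \<and> enlargement B (\<delta> n) \<subseteq> U n))}"

definition S1 :: "'b set set \<Rightarrow> 'b set set \<Rightarrow> bool" where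
  "S1 \<A> \<C> \<longleftrightarrow>
     (\<forall>\<U> :: nat \<Rightarrow> 'b set. (\<forall>n. \<U> n \<in> \<A>) \<longrightarrow>
        (\<exists>U. (\<forall>n. U n \<in> \<U> n) \<and> range U \<in> \<C>))"

definition alpha2 :: "'b set set \<Rightarrow> 'b set set \<Rightarrow> bool" where
  "alpha2 \<A> \<C> \<longleftrightarrow>
     (\<forall>\<U> :: nat \<Rightarrow> 'b set. (\<forall>n. \<U> n \<in> \<A>) \<longrightarrow>
        (\<exists>\<V>\<in>\<C>. \<forall>n. infinite (\<U> n \<inter> \<V>)))"

definition alpha3 :: "'b set set \<Rightarrow> 'b set set \<Rightarrow> bool" where
  "alpha3 \<A> \<C> \<longleftrightarrow>
     (\<forall>\<U> :: nat \<Rightarrow> 'b set. (\<forall>n. \<U> n \<in> \<A>) \<longrightarrow>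
        (\<exists>\<V>\<in>\<C>. infinite {n. infinite (\<U> n \<inter> \<V>)}))"

definition alpha4 :: "'b set set \<Rightarrow> 'b set set \<Rightarrow> bool" where
  "alpha4 \<A> \<C> \<longleftrightarrow>
     (\<forall>\<U> :: nat \<Rightarrow> 'b set. (\<forall>n. \<U> n \<in> \<A>) \<longrightarrow>
        (\<exists>\<V>\<in>\<C>. infinite {n. \<U> n \<inter> \<V> \<noteq> {}}))"

end

theory Submission imports Defs begin

text \<open>
  A set is a \<open>\<gamma>\<close>-cover iff it is a countably infinite family of open sets in which, for each \<open>B\<close>,
  only finitely many members contain no enlargement of \<open>B\<close>; hence infinite subsets of
  \<open>\<gamma>\<close>-covers are \<open>\<gamma>\<close>-covers.  Enumerating the union of a sequence of \<open>\<gamma>\<close>-covers and deleting the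
  whole space and the first \<open>n\<close> listed sets from the \<open>n\<close>-th cover, one may assume that every set lies in
  only finitely many of the covers.

  For \<open>\<alpha>\<^sub>4 \<Longrightarrow> S\<^sub>1\<close>, apply \<open>\<alpha>\<^sub>4\<close> to the (thinned) covers
  \<open>{U\<^bsub>0,m\<^esub> \<inter> \<dots> \<inter> U\<^bsub>n,m\<^esub> : m}\<close>; a set picked from the \<open>n\<close>-th one lies below a
  member of each of the first \<open>n\<close> given covers, which fills the gaps between the indices provided
  by \<open>\<alpha>\<^sub>4\<close>.  For \<open>S\<^sub>1 \<Longrightarrow> \<alpha>\<^sub>2\<close>, apply \<open>S\<^sub>1\<close> to the thinned sequence in which each
  given cover is repeated infinitely often.
\<close>

section \<open>Sets that contain an enlargement of a given set\<close>

definition strongly_inside :: "'a::metric_space set \<Rightarrow> 'a set \<Rightarrow> bool" where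
  "strongly_inside B U \<longleftrightarrow> (\<exists>\<delta>>0. enlargement B \<delta> \<subseteq> U)"

lemma strongly_inside_subset: "strongly_inside B U \<Longrightarrow> B \<subseteq> U"
  by (force simp: strongly_inside_def enlargement_def)

lemma strongly_inside_mono: "strongly_inside B U \<Longrightarrow> U \<subseteq> V \<Longrightarrow> strongly_inside B V"
  unfolding strongly_inside_def by blast

lemma strongly_inside_Inter:
  assumes "finite I" and "\<And>i. i \<in> I \<Longrightarrow> strongly_inside B (U i)"
  shows "strongly_inside B (\<Inter>i\<in>I. U i)"
  using assms
proof (induction I rule: finite_induct)
  case empty
  show ?case by (auto simp: strongly_inside_def intro: exI[of _ 1])
next
  case (insert i I)
  obtain d where d: "d > 0" "enlargement B d \<subseteq> U i"
    using insert.prems unfolding strongly_inside_def by blast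
  obtain e where e: "e > 0" "enlargement B e \<subseteq> (\<Inter>i\<in>I. U i)"
    using insert unfolding strongly_inside_def by (metis insertCI)
  have "enlargement B (min d e) \<subseteq> enlargement B d \<inter> enlargement B e"
    by (auto simp: enlargement_def)
  then show ?case
    using d e unfolding strongly_inside_def by (intro exI[of _ "min d e"]) auto
qed

section \<open>Gamma-covers as sequences and as countable families\<close>

lemma gamma_seqE:
  assumes "\<U> \<in> \<Gamma> \<BB>"
  obtains U :: "nat \<Rightarrow> 'a::metric_space set" where "\<U> = range U"
    and "\<And>B. B \<in> \<BB> \<Longrightarrow> eventually (\<lambda>n. strongly_inside B (U n)) sequentially"
proof -
  obtain U where U: "\<U> = range U"
    and *: "\<And>B. B \<in> \<BB> \<Longrightarrow> \<exists>n0. \<exists>\<delta> :: nat \<Rightarrow> real. \<forall>n\<ge>n0. \<delta> n > 0 \<and> enlargement B (\<delta> n) \<subseteq> U n"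
    using assms unfolding gamma_covers_def by auto
  show ?thesis
  proof (rule that[OF U])
    fix B assume "B \<in> \<BB>"
    then obtain n0 and \<delta> :: "nat \<Rightarrow> real"
      where "\<forall>n\<ge>n0. \<delta> n > 0 \<and> enlargement B (\<delta> n) \<subseteq> U n"
      using * by blast
    then show "eventually (\<lambda>n. strongly_inside B (U n)) sequentially"
      unfolding eventually_sequentially strongly_inside_def by blast
  qed
qed

text \<open>The radii can be chosen one index at a time, which turns the \<gamma>-condition into a
  plain \<open>eventually\<close> statement about \<open>strongly_inside\<close>.\<close>

lemma gamma_seqI:
  assumes "open_cover (range U)" "infinite (range U)"
    and ev: "\<And>B. B \<in> \<BB> \<Longrightarrow> eventually (\<lambda>n. strongly_inside B (U n)) sequentially"
  shows "range U \<in> \<Gamma> \<BB>"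
proof -
  have "\<exists>n0. \<exists>\<delta> :: nat \<Rightarrow> real. \<forall>n\<ge>n0. \<delta> n > 0 \<and> enlargement B (\<delta> n) \<subseteq> U n" if "B \<in> \<BB>" for B
    using ev[OF that] unfolding eventually_sequentially strongly_inside_def by metis
  then show ?thesis
    using assms unfolding gamma_covers_def by blast
qed

text \<open>Along the naturals, eventually means at all but finitely many indices. From indices to
  members one takes the image of the exceptional set; back, its preimage under an injective
  enumeration, which exists because the family is countably infinite.\<close>

lemma gamma_iff:
  fixes \<BB> :: "'a::metric_space set set"
  assumes "\<Union>\<BB> = UNIV"
  shows "\<U> \<in> \<Gamma> \<BB> \<longleftrightarrow> countable \<U> \<and> infinite \<U> \<and> (\<forall>U\<in>\<U>. open U) \<and>
           (\<forall>B\<in>\<BB>. finite {U\<in>\<U>. \<not> strongly_inside B U})"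
proof (intro iffI conjI)
  assume g: "\<U> \<in> \<Gamma> \<BB>"
  then show "infinite \<U>" "\<forall>U\<in>\<U>. open U"
    by (auto simp: gamma_covers_def open_cover_def)
  obtain U where U: "\<U> = range U"
    "\<And>B. B \<in> \<BB> \<Longrightarrow> eventually (\<lambda>n. strongly_inside B (U n)) sequentially"
    using gamma_seqE[OF g] by blast
  then show "countable \<U>" by simp
  show "\<forall>B\<in>\<BB>. finite {U\<in>\<U>. \<not> strongly_inside B U}"
  proof
    fix B assume "B \<in> \<BB>"
    then have "finite {n. \<not> strongly_inside B (U n)}"
      using U(2) by (simp add: cofinite_eq_sequentially[symmetric] eventually_cofinite)
    moreover have "{V\<in>\<U>. \<not> strongly_inside B V} = U ` {n. \<not> strongly_inside B (U n)}"
      using U(1) by auto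
    ultimately show "finite {V\<in>\<U>. \<not> strongly_inside B V}" by simp
  qed
next
  assume *: "countable \<U> \<and> infinite \<U> \<and> (\<forall>U\<in>\<U>. open U) \<and>
           (\<forall>B\<in>\<BB>. finite {U\<in>\<U>. \<not> strongly_inside B U})"
  then have bij: "bij_betw (from_nat_into \<U>) UNIV \<U>"
    by (simp add: bij_betw_from_nat_into)
  then have range: "range (from_nat_into \<U>) = \<U>"
    by (simp add: bij_betw_def)
  have "x \<in> \<Union>\<U>" for x
  proof -
    obtain B where B: "B \<in> \<BB>" "x \<in> B" using assms by blast
    \<comment> \<open>Otherwise the infinite family would equal its finite exceptional part.\<close>
    then obtain U where "U \<in> \<U>" "strongly_inside B U"
      using * by (metis (no_types, lifting) mem_Collect_eq finite_subset subsetI)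
    then show ?thesis using strongly_inside_subset B by blast
  qed
  then have "open_cover \<U>" using * by (auto simp: open_cover_def)
  moreover have "eventually (\<lambda>n. strongly_inside B (from_nat_into \<U> n)) sequentially"
    if "B \<in> \<BB>" for B
  proof -
    have "finite (from_nat_into \<U> -` {U\<in>\<U>. \<not> strongly_inside B U})"
      using * that bij by (intro finite_vimageI) (auto simp: bij_betw_def)
    moreover have "from_nat_into \<U> -` {U\<in>\<U>. \<not> strongly_inside B U}
        = {n. \<not> strongly_inside B (from_nat_into \<U> n)}"
      using range by auto
    ultimately show ?thesis
      by (simp add: cofinite_eq_sequentially[symmetric] eventually_cofinite)
  qed
  ultimately have "range (from_nat_into \<U>) \<in> \<Gamma> \<BB>"
    using * range by (intro gamma_seqI) auto
  then show "\<U> \<in> \<Gamma> \<BB>" using range by simp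
qed

lemma gamma_subset:
  fixes \<BB> :: "'a::metric_space set set"
  assumes "\<Union>\<BB> = UNIV" "\<U> \<in> \<Gamma> \<BB>" "\<V> \<subseteq> \<U>" "infinite \<V>"
  shows "\<V> \<in> \<Gamma> \<BB>"
proof -
  have "finite {U\<in>\<V>. \<not> strongly_inside B U}" if "B \<in> \<BB>" for B
    by (rule finite_subset[of _ "{U\<in>\<U>. \<not> strongly_inside B U}"])
      (use assms that in \<open>auto simp: gamma_iff\<close>)
  then show ?thesis
    using assms countable_subset[of \<V> \<U>] by (auto simp: gamma_iff)
qed

text \<open>Infinitude follows once no member is the whole space: in a finite range some
  \<open>U k\<close> would occur infinitely often, so it would contain every \<open>B\<close> and
  hence be everything.\<close>

lemma gamma_range:
  fixes \<BB> :: "'a::metric_space set set"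
  assumes cov: "\<Union>\<BB> = UNIV" and opn: "\<And>n. open (U n)" and ne: "\<And>n. U n \<noteq> UNIV"
    and ev: "\<And>B. B \<in> \<BB> \<Longrightarrow> eventually (\<lambda>n. strongly_inside B (U n)) sequentially"
  shows "range U \<in> \<Gamma> \<BB>"
proof (rule gamma_seqI)
  show "infinite (range U)"
  proof
    assume "finite (range U)"
    then obtain k where "infinite {n \<in> UNIV. U n = U k}"
      using pigeonhole_infinite[OF infinite_UNIV_nat] by blast
    then have k: "infinite {n. U n = U k}" by simp
    have "B \<subseteq> U k" if B: "B \<in> \<BB>" for B
    proof -
      have "finite {n. \<not> strongly_inside B (U n)}"
        using ev[OF B] by (simp add: cofinite_eq_sequentially[symmetric] eventually_cofinite)
      then have "\<not> {n. U n = U k} \<subseteq> {n. \<not> strongly_inside B (U n)}"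
        using k finite_subset by blast
      then have "strongly_inside B (U k)" by auto
      then show ?thesis by (rule strongly_inside_subset)
    qed
    then have "\<Union>\<BB> \<subseteq> U k" by (rule Union_least)
    then show False using cov ne[of k] by auto
  qed
  have "x \<in> \<Union>(range U)" for x
  proof -
    obtain B where B: "B \<in> \<BB>" "x \<in> B" using cov by blast
    then obtain n where "strongly_inside B (U n)"
      using ev[OF B(1)] by (auto simp: eventually_sequentially)
    then show ?thesis using strongly_inside_subset B by blast
  qed
  then show "open_cover (range U)" using opn by (auto simp: open_cover_def)
qed (fact ev)

lemma gamma_thin:
  fixes \<BB> :: "'a::metric_space set set" and \<U> :: "nat \<Rightarrow> 'a set set"
  assumes cov: "\<Union>\<BB> = UNIV" and g: "\<And>n. \<U> n \<in> \<Gamma> \<BB>"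
  obtains \<W> where "\<And>n. \<W> n \<in> \<Gamma> \<BB>" "\<And>n. \<W> n \<subseteq> \<U> n - {UNIV}" "\<And>V. finite {n. V \<in> \<W> n}"
proof
  define e where "e = from_nat_into (\<Union>n. \<U> n)"
  \<comment> \<open>The set \<open>e k\<close> is deleted from the \<open>k\<close>-th cover and all
    later ones, so it survives at most at indices below \<open>k\<close>; each single cover loses
    only finitely many sets.\<close>
  define \<W> where "\<W> n = \<U> n - (insert UNIV (e ` {..n}))" for n
  have "countable (\<Union>n. \<U> n)" using g cov by (simp add: gamma_iff)
  then have e: "\<exists>k. e k = V" if "V \<in> \<U> n" for V n
    using that unfolding e_def by (meson UNIV_I UN_I from_nat_into_surj)
  show "\<W> n \<subseteq> \<U> n - {UNIV}" for n by (auto simp: \<W>_def)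
  have "infinite (\<W> n)" for n
    using g[of n] cov unfolding \<W>_def by (simp add: gamma_iff)
  then show "\<W> n \<in> \<Gamma> \<BB>" for n
    using gamma_subset[OF cov g[of n]] by (auto simp: \<W>_def)
  show "finite {n. V \<in> \<W> n}" for V
  proof (cases "\<exists>n. V \<in> \<U> n")
    case True
    then obtain k where "e k = V" using e by blast
    then have "{n. V \<in> \<W> n} \<subseteq> {..<k}" by (force simp: \<W>_def)
    then show ?thesis by (rule finite_subset) simp
  qed (auto simp: \<W>_def)
qed

section \<open>From the selection principle to \<open>alpha4\<close>\<close>

lemma S1_imp_alpha2:
  fixes \<BB> :: "'a::metric_space set set"
  assumes cov: "\<Union>\<BB> = UNIV" and S1: "S1 (\<Gamma> \<BB>) (\<Gamma> \<BB>)"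
  shows "alpha2 (\<Gamma> \<BB>) (\<Gamma> \<BB>)"
  unfolding alpha2_def
proof (intro allI impI)
  fix \<U> :: "nat \<Rightarrow> 'a set set"
  assume g: "\<forall>n. \<U> n \<in> \<Gamma> \<BB>"
  obtain \<W> where W: "\<And>p. \<W> p \<in> \<Gamma> \<BB>" "\<And>p. \<W> p \<subseteq> \<U> (fst (prod_decode p)) - {UNIV}"
    "\<And>V. finite {p. V \<in> \<W> p}"
    using gamma_thin[OF cov, of "\<lambda>p. \<U> (fst (prod_decode p))"] g by blast
  obtain U where U: "\<And>p. U p \<in> \<W> p" "range U \<in> \<Gamma> \<BB>"
    using S1 W(1) unfolding S1_def by blast
  have "infinite (\<U> n \<inter> range U)" for n
  proof
    assume fin: "finite (\<U> n \<inter> range U)"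
    define P where "P = range (\<lambda>k. prod_encode (n, k))"
    have "inj (\<lambda>k. prod_encode (n, k))"
      by (simp add: inj_on_def)
    then have "infinite P"
      unfolding P_def using finite_imageD infinite_UNIV_nat by blast
    moreover have "U (prod_encode (n, k)) \<in> \<U> n" for k
      using U(1)[of "prod_encode (n, k)"] W(2)[of "prod_encode (n, k)"] by auto
    then have "U ` P \<subseteq> \<U> n \<inter> range U"
      by (auto simp: P_def)
    \<comment> \<open>Each \<open>p\<close> in \<open>P\<close> is among the finitely many indices
      whose cover contains \<open>U p\<close>, so finitely many picks \<open>U p\<close> would make
      the infinite set \<open>P\<close> finite.\<close>
    then have "P \<subseteq> (\<Union>V\<in>\<U> n \<inter> range U. {p. V \<in> \<W> p})"
      using U(1) by blast
    ultimately show False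
      using fin W(3) finite_subset by blast
  qed
  then show "\<exists>\<V>\<in>\<Gamma> \<BB>. \<forall>n. infinite (\<U> n \<inter> \<V>)"
    using U(2) by blast
qed

lemma alpha2_imp_alpha3:
  assumes "alpha2 \<A> \<C>"
  shows "alpha3 \<A> \<C>"
  unfolding alpha3_def
proof (intro allI impI)
  fix \<U> :: "nat \<Rightarrow> 'a set"
  assume "\<forall>n. \<U> n \<in> \<A>"
  then obtain \<V> where "\<V> \<in> \<C>" "\<forall>n. infinite (\<U> n \<inter> \<V>)"
    using assms unfolding alpha2_def by blast
  then show "\<exists>\<V>\<in>\<C>. infinite {n. infinite (\<U> n \<inter> \<V>)}"
    by (intro bexI[of _ \<V>]) auto
qed

lemma alpha3_imp_alpha4:
  assumes "alpha3 \<A> \<C>"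
  shows "alpha4 \<A> \<C>"
  unfolding alpha4_def
proof (intro allI impI)
  fix \<U> :: "nat \<Rightarrow> 'a set"
  assume "\<forall>n. \<U> n \<in> \<A>"
  then obtain \<V> where "\<V> \<in> \<C>" "infinite {n. infinite (\<U> n \<inter> \<V>)}"
    using assms unfolding alpha3_def by blast
  moreover have "{n. infinite (\<U> n \<inter> \<V>)} \<subseteq> {n. \<U> n \<inter> \<V> \<noteq> {}}" by auto
  ultimately show "\<exists>\<V>\<in>\<C>. infinite {n. \<U> n \<inter> \<V> \<noteq> {}}"
    using finite_subset by blast
qed

section \<open>From \<open>alpha4\<close> back to the selection principle\<close>

lemma gamma_common_refinement:
  fixes \<BB> :: "'a::metric_space set set" and \<U> :: "nat \<Rightarrow> 'a set set"
  assumes cov: "\<Union>\<BB> = UNIV" and g: "\<And>n. \<U> n \<in> \<Gamma> \<BB>" and ne: "\<And>n. UNIV \<notin> \<U> n"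
  obtains \<W> where "\<And>n. \<W> n \<in> \<Gamma> \<BB>" "\<And>n i V. V \<in> \<W> n \<Longrightarrow> i \<le> n \<Longrightarrow> \<exists>U\<in>\<U> i. V \<subseteq> U"
proof -
  have "\<exists>U :: nat \<Rightarrow> 'a set. \<U> i = range U \<and>
      (\<forall>B\<in>\<BB>. eventually (\<lambda>n. strongly_inside B (U n)) sequentially)" for i
    using gamma_seqE[OF g[of i]] by metis
  then obtain U :: "nat \<Rightarrow> nat \<Rightarrow> 'a set" where U: "\<And>i. \<U> i = range (U i)"
    "\<And>i B. B \<in> \<BB> \<Longrightarrow> eventually (\<lambda>n. strongly_inside B (U i n)) sequentially"
    by metis
  \<comment> \<open>Only the first \<open>n + 1\<close> enumerations enter, so for each
    \<open>B\<close> they are all past their thresholds once \<open>m\<close> is large.\<close>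
  define W where "W n m = (\<Inter>i\<in>{..n}. U i m)" for n m
  show ?thesis
  proof (rule that)
    show "range (W n) \<in> \<Gamma> \<BB>" for n
    proof (rule gamma_range[OF cov])
      have "open (U i m)" for i m
        using g[of i] U(1)[of i] cov by (auto simp: gamma_iff)
      then show "open (W n m)" for m
        unfolding W_def by (intro open_INT) auto
      show "W n m \<noteq> UNIV" for m
      proof -
        have "U 0 m \<noteq> UNIV"
          using ne[of 0] U(1)[of 0] by (metis rangeI)
        moreover have "W n m \<subseteq> U 0 m"
          by (auto simp: W_def)
        ultimately show ?thesis by auto
      qed
      show "eventually (\<lambda>m. strongly_inside B (W n m)) sequentially" if "B \<in> \<BB>" for B
      proof -
        have "eventually (\<lambda>m. \<forall>i\<in>{..n}. strongly_inside B (U i m)) sequentially"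
          using U(2)[OF that] by (intro eventually_ball_finite) auto
        then show ?thesis
          by eventually_elim (auto simp: W_def intro!: strongly_inside_Inter)
      qed
    qed
    show "\<exists>U\<in>\<U> i. V \<subseteq> U" if "V \<in> range (W n)" "i \<le> n" for n i V
    proof -
      from that(1) obtain m where "V = W n m" by blast
      then have "V \<subseteq> U i m" using that(2) by (auto simp: W_def)
      then show ?thesis using U(1)[of i] by blast
    qed
  qed
qed

lemma alpha4_imp_S1:
  fixes \<BB> :: "'a::metric_space set set"
  assumes cov: "\<Union>\<BB> = UNIV" and a4: "alpha4 (\<Gamma> \<BB>) (\<Gamma> \<BB>)"
  shows "S1 (\<Gamma> \<BB>) (\<Gamma> \<BB>)"
  unfolding S1_def
proof (intro allI impI)
  fix \<U> :: "nat \<Rightarrow> 'a set set"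
  assume g: "\<forall>n. \<U> n \<in> \<Gamma> \<BB>"
  \<comment> \<open>Thinning is used twice: here to discard the whole space, as the refinement and
    \<open>gamma_range\<close> require; later to let each set lie in only finitely many refined
    covers.\<close>
  obtain \<U>' where U': "\<And>n. \<U>' n \<in> \<Gamma> \<BB>" "\<And>n. \<U>' n \<subseteq> \<U> n - {UNIV}"
    using gamma_thin[OF cov, of \<U>] g by metis
  have ne: "UNIV \<notin> \<U>' n" for n using U'(2)[of n] by blast
  obtain \<W> where W: "\<And>n. \<W> n \<in> \<Gamma> \<BB>"
    "\<And>n i V. V \<in> \<W> n \<Longrightarrow> i \<le> n \<Longrightarrow> \<exists>U\<in>\<U>' i. V \<subseteq> U"
    by (rule gamma_common_refinement[of \<BB> \<U>', OF cov U'(1) ne]) (rule that)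
  obtain \<W>' where W': "\<And>n. \<W>' n \<in> \<Gamma> \<BB>" "\<And>n. \<W>' n \<subseteq> \<W> n - {UNIV}"
    "\<And>V. finite {n. V \<in> \<W>' n}"
    by (rule gamma_thin[of \<BB> \<W>, OF cov W(1)]) (rule that)
  obtain \<V> where V: "\<V> \<in> \<Gamma> \<BB>" "infinite {n. \<W>' n \<inter> \<V> \<noteq> {}}"
    using a4 W'(1) unfolding alpha4_def by blast
  \<comment> \<open>Since \<open>\<W>' (k n)\<close> refines the \<open>n\<close>-th cover whenever
    \<open>k n \<ge> n\<close>, every \<open>n\<close> gets a selection, even if \<open>\<V>\<close>
    misses \<open>\<W>' n\<close>. The same \<open>S n\<close> may serve several
    \<open>n\<close>.\<close>
  have "\<exists>k\<ge>n. \<exists>S. S \<in> \<W>' k \<inter> \<V>" for n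
    using V(2) unfolding infinite_nat_iff_unbounded_le by blast
  then obtain k S where kS: "\<And>n. k n \<ge> n" "\<And>n. S n \<in> \<W>' (k n)" "\<And>n. S n \<in> \<V>"
    by (metis IntE)
  have "\<exists>U. U \<in> \<U>' n \<and> S n \<subseteq> U" for n
    using W(2)[of "S n" "k n" n] kS W'(2)[of "k n"] by blast
  then obtain U where U: "\<And>n. U n \<in> \<U>' n" "\<And>n. S n \<subseteq> U n" by metis
  have "range U \<in> \<Gamma> \<BB>"
  proof (rule gamma_range[OF cov])
    show "open (U n)" for n
      using U(1)[of n] U'(1)[of n] cov by (auto simp: gamma_iff)
    show "U n \<noteq> UNIV" for n
      using U(1)[of n] U'(2)[of n] by blast
    fix B assume B: "B \<in> \<BB>"
    \<comment> \<open>\<open>K\<close> collects the cover indices at which an exceptional member of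
      \<open>\<V>\<close> could be picked. It is finite because each of the finitely many
      exceptional members lies in finitely many covers; \<open>k n \<ge> n\<close> moves the picks
      past it.\<close>
    define K where "K = (\<Union>V\<in>{V\<in>\<V>. \<not> strongly_inside B V}. {n. V \<in> \<W>' n})"
    have "finite K"
      unfolding K_def using V(1) B cov W'(3) by (auto simp: gamma_iff)
    then obtain m where m: "K \<subseteq> {..<m}"
      unfolding finite_nat_iff_bounded ..
    have "strongly_inside B (U n)" if "n \<ge> m" for n
    proof -
      have "k n \<notin> K" using m kS(1)[of n] that by auto
      then have "strongly_inside B (S n)"
        using kS(2)[of n] kS(3)[of n] unfolding K_def by blast
      then show ?thesis using U(2) by (rule strongly_inside_mono)
    qed
    then show "eventually (\<lambda>n. strongly_inside B (U n)) sequentially"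
      unfolding eventually_sequentially by blast
  qed
  then show "\<exists>U. (\<forall>n. U n \<in> \<U> n) \<and> range U \<in> \<Gamma> \<BB>"
    using U(1) U'(2) by (intro exI[of _ U]) blast
qed

theorem theorem3p1:
  fixes \<BB> :: "'a::metric_space set set"
  assumes "bornology \<BB>"
    and "UNIV \<notin> \<BB>"
    and "strong_Lindelof \<BB>"
  shows "(alpha2 (\<Gamma> \<BB>) (\<Gamma> \<BB>) \<longleftrightarrow> alpha3 (\<Gamma> \<BB>) (\<Gamma> \<BB>))
       \<and> (alpha3 (\<Gamma> \<BB>) (\<Gamma> \<BB>) \<longleftrightarrow> alpha4 (\<Gamma> \<BB>) (\<Gamma> \<BB>))
       \<and> (alpha4 (\<Gamma> \<BB>) (\<Gamma> \<BB>) \<longleftrightarrow> S1 (\<Gamma> \<BB>) (\<Gamma> \<BB>))"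
proof -
  have "\<Union>\<BB> = UNIV" using assms(1) by (simp add: bornology_def)
  \<comment> \<open>The implications close the cycle \<open>S1\<close>, \<open>alpha2\<close>,
    \<open>alpha3\<close>, \<open>alpha4\<close>, \<open>S1\<close>.\<close>
  then show ?thesis
    using S1_imp_alpha2[of \<BB>] alpha4_imp_S1[of \<BB>]
      alpha2_imp_alpha3[of "\<Gamma> \<BB>" "\<Gamma> \<BB>"] alpha3_imp_alpha4[of "\<Gamma> \<BB>" "\<Gamma> \<BB>"]
    by argo
qed

end
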